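(* Let $(\mathbb{R}^2,\mu)$ be a KV-algebra with structure constants $\Gamma_{ij}^k$. Then: (i) $\ker\delta^0$ is the set of elements $\xi=(\xi_1,\xi_2)\in J(\mathbb{R}^2)$ satisfying $$\begin{cases}(\Gamma_{21}^{1}-\Gamma_{12}^{1})\xi_{2}=0\\ (\Gamma_{12}^{1}-\Gamma_{21}^{1})\xi_{1}=0\\ (\Gamma_{21}^{2}-\Gamma_{12}^{2})\xi_{2}=0\\ (\Gamma_{12}^{2}-\Gamma_{21}^{2})\xi_{1}=0.\end{cases}$$ (ii) $\ker\delta^1$ is the set of linear maps $f_1\in C^1(\mathbb{R}^2)$ with matrix $\begin{pmatrix}\alpha&\beta\\ \gamma&\lambda\end{pmatrix}$ satisfying $$\begin{cases} -\Gamma_{11}^{1}\alpha+\Gamma_{11}^{2}\beta-(\Gamma_{12}^{1}+\Gamma_{21}^{1})\gamma=0\\ (\Gamma_{12}^{2}-\Gamma_{11}^{1})\beta-\Gamma_{22}^{1}\gamma-\Gamma_{12}^{1}\lambda=0\\ (\Gamma_{11}^{2}-\Gamma_{11}^{1})\beta-\Gamma_{22}^{1}\gamma-\Gamma_{21}^{1}\lambda=0\\ \Gamma_{22}^{1}\alpha+(\Gamma_{22}^{2}-\Gamma_{12}^{1}-\Gamma_{21}^{1})\beta-2\Gamma_{22}^{1}\lambda=0\\ -2\Gamma_{11}^{2}\alpha+(\Gamma_{11}^{1}-\Gamma_{12}^{2}-\Gamma_{21}^{2})\gamma+\Gamma_{11}^{2}\lambda=0\\ -\Gamma_{12}^{2}\alpha-\Gamma_{11}^{2}\beta+(\Gamma_{12}^{1}-\Gamma_{22}^{2})\gamma=0\\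 -\Gamma_{21}^{2}\alpha-\Gamma_{11}^{2}\beta+(\Gamma_{21}^{1}-\Gamma_{22}^{2})\gamma=0\\ -(\Gamma_{21}^{2}+\Gamma_{12}^{2})\beta+\Gamma_{22}^{1}\gamma-\Gamma_{22}^{2}\lambda=0. \end{cases}$$ (iii) $\ker\delta^2$ is the set of bilinear maps $f_2\in C^2(\mathbb{R}^2)$ with matrices $\left(\begin{pmatrix} e & f \\ g & h \end{pmatrix},\begin{pmatrix} i & j \\ k & l \end{pmatrix}\right)$ satisfying $$\begin{cases} (\Gamma_{12}^{1}-\Gamma_{21}^{1})e+\Gamma_{22}^{1}i+(\Gamma_{11}^{1}-\Gamma_{21}^{2})f+\Gamma_{21}^{1}j+(\Gamma_{12}^{2}-\Gamma_{11}^{1}-\Gamma_{21}^{2})g-(\Gamma_{12}^{1}+\Gamma_{21}^{1})k+\Gamma_{11}^{2}h=0\\ \Gamma_{21}^{2}e+(\Gamma_{12}^{1}-2\Gamma_{21}^{1}+\Gamma_{22}^{2})i+\Gamma_{11}^{2}f-2\Gamma_{11}^{2}g+(\Gamma_{11}^{1}-2\Gamma_{21}^{2})k+\Gamma_{11}^{2}l=0\\ -\Gamma_{22}^{1}e+(2\Gamma_{12}^{1}-\Gamma_{22}^{2})f+2\Gamma_{22}^{1}j-\Gamma_{22}^{1}k+(2\Gamma_{12}^{2}-\Gamma_{11}^{1}-\Gamma_{21}^{2})h-\Gamma_{12}^{1}l=0\\ -\Gamma_{22}^{1}i+(\Gamma_{12}^{2}+\Gamma_{21}^{2})f+(\Gamma_{12}^{1}-\Gamma_{21}^{1}+\Gamma_{22}^{2})j-\Gamma_{12}^{1}g+(\Gamma_{12}^{1}-\Gamma_{22}^{2})k-\Gamma_{11}^{2}h+(\Gamma_{12}^{2}-\Gamma_{21}^{2})l=0.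 \end{cases}$$
   Context: Fix a basis $(e_1,e_2)$ of $\mathbb{R}^2$. A bilinear map $\mu:\mathbb{R}^2\times\mathbb{R}^2\to\mathbb{R}^2$, also written $uv=\mu(u,v)$, is identified with the pair of matrices $\Gamma_1=(\Gamma_{ij}^1)$, $\Gamma_2=(\Gamma_{ij}^2)$ by $\mu(u,v)=(u^t\Gamma_1v,\,u^t\Gamma_2v)$, i.e. $\mu(e_i,e_j)=\Gamma_{ij}^1e_1+\Gamma_{ij}^2e_2$. Put $Ass_\mu(u,v,w)=(uv)w-u(vw)$. $(\mathbb{R}^2,\mu)$ is a KV-algebra (Koszul-Vinberg algebra) if $Ass_\mu(u,v,w)=Ass_\mu(v,u,w)$ for all $u,v,w$. The KV-complex is $0\to C^0(\mathbb{R}^2)\xrightarrow{\delta^0}C^1(\mathbb{R}^2)\xrightarrow{\delta^1}C^2(\mathbb{R}^2)\xrightarrow{\delta^2}C^3(\mathbb{R}^2)\to\cdots$, where $C^0(\mathbb{R}^2)=J(\mathbb{R}^2)=\{\xi\in\mathbb{R}^2: Ass_\mu(u,v,\xi)=0\ \forall u,v\in\mathbb{R}^2\}$, and for $q\ge1$, $C^q(\mathbb{R}^2)$ is the space of $q$-linear maps $(\mathbb{R}^2)^q\to\mathbb{R}^2$. The coboundaries are $\delta^0(\xi)(u)=-u\xi+\xi u$; $\delta^1f(u,v)=-u f(v)+f(uv)-f(u)v$; $\delta^2f(u,v,w)=v f(u,w)-u f(v,w)+f(v,uw)-f(u,vw)+f(uv,w)-f(vu,w)+f(u,v)w-f(v,u)w$.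 A linear map with matrix $\begin{pmatrix}\alpha&\beta\\ \gamma&\lambda\end{pmatrix}$ is $f_1(x,y)=(\alpha x+\beta y,\gamma x+\lambda y)$. A bilinear map with matrices $(C,D)$ is $f_2(u,v)=(u^tCv,u^tDv)$.
   Formalization: Two misprinted coefficients are corrected: in (ii), third equation, $(\Gamma_{11}^2-\Gamma_{11}^1)\beta$ becomes $(\Gamma_{21}^2-\Gamma_{11}^1)\beta$; in (iii), fourth equation, $-\Gamma_{12}^1 g$ becomes $-\Gamma_{12}^2 g$. *)

theory Defs
  imports "HOL-Analysis.Analysis"
begin

definition associator :: "('a \<Rightarrow> 'a \<Rightarrow> 'a) \<Rightarrow> 'a \<Rightarrow> 'a \<Rightarrow> 'a \<Rightarrow> 'a::real_vector" where
  "associator \<mu> u v w = \<mu> (\<mu> u v) w - \<mu> u (\<mu> v w)"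

definition KV_algebra :: "('a::real_vector \<Rightarrow> 'a \<Rightarrow> 'a) \<Rightarrow> bool" where
  "KV_algebra \<mu> \<longleftrightarrow>
     bilinear \<mu> \<and> (\<forall>u v w. associator \<mu> u v w = associator \<mu> v u w)"

definition KV_C0 :: "('a::real_vector \<Rightarrow> 'a \<Rightarrow> 'a) \<Rightarrow> 'a set" where
  "KV_C0 \<mu> = {\<xi>. \<forall>u v. associator \<mu> u v \<xi> = 0}"

definition KV_C1 :: "('a::real_vector \<Rightarrow> 'a) set" where
  "KV_C1 = {f. linear f}"

definition KV_C2 :: "('a::real_vector \<Rightarrow> 'a \<Rightarrow> 'a) set" where
  "KV_C2 = {f. bilinear f}"

definition KV_d0 :: "('a::real_vector \<Rightarrow> 'a \<Rightarrow> 'a) \<Rightarrow> 'a \<Rightarrow> 'a \<Rightarrow> 'a" where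
  "KV_d0 \<mu> \<xi> u = - \<mu> u \<xi> + \<mu> \<xi> u"

definition KV_d1 :: "('a::real_vector \<Rightarrow> 'a \<Rightarrow> 'a) \<Rightarrow> ('a \<Rightarrow> 'a) \<Rightarrow> 'a \<Rightarrow> 'a \<Rightarrow> 'a" where
  "KV_d1 \<mu> f u v = - \<mu> u (f v) + f (\<mu> u v) - \<mu> (f u) v"

definition KV_d2 :: "('a::real_vector \<Rightarrow> 'a \<Rightarrow> 'a) \<Rightarrow> ('a \<Rightarrow> 'a \<Rightarrow> 'a) \<Rightarrow> 'a \<Rightarrow> 'a \<Rightarrow> 'a \<Rightarrow> 'a" where
  "KV_d2 \<mu> f u v w =
     \<mu> v (f u w) - \<mu> u (f v w) + f v (\<mu> u w) - f u (\<mu> v w)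
     + f (\<mu> u v) w - f (\<mu> v u) w + \<mu> (f u v) w - \<mu> (f v u) w"

definition ker_d0 :: "('a::real_vector \<Rightarrow> 'a \<Rightarrow> 'a) \<Rightarrow> 'a set" where
  "ker_d0 \<mu> = {\<xi> \<in> KV_C0 \<mu>. \<forall>u. KV_d0 \<mu> \<xi> u = 0}"

definition ker_d1 :: "('a::real_vector \<Rightarrow> 'a \<Rightarrow> 'a) \<Rightarrow> ('a \<Rightarrow> 'a) set" where
  "ker_d1 \<mu> = {f \<in> KV_C1. \<forall>u v. KV_d1 \<mu> f u v = 0}"

definition ker_d2 :: "('a::real_vector \<Rightarrow> 'a \<Rightarrow> 'a) \<Rightarrow> ('a \<Rightarrow> 'a \<Rightarrow> 'a) set" where
  "ker_d2 \<mu> = {f \<in> KV_C2. \<forall>u v w. KV_d2 \<mu> f u v w = 0}"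

definition is_basis2 :: "real^2 \<Rightarrow> real^2 \<Rightarrow> bool" where
  "is_basis2 e1 e2 \<longleftrightarrow> e1 \<noteq> e2 \<and> independent {e1, e2} \<and> span {e1, e2} = UNIV"

text \<open>The vector whose coordinates in the ordered basis \<open>(e1, e2)\<close> are \<open>x\<close>. Coordinates and
  matrices below always refer to such a basis, which need not be the standard one.\<close>

definition from_coords :: "real^2 \<Rightarrow> real^2 \<Rightarrow> real^2 \<Rightarrow> real^2" where
  "from_coords e1 e2 x = x$1 *\<^sub>R e1 + x$2 *\<^sub>R e2"

definition linear_matrix ::
    "real^2 \<Rightarrow> real^2 \<Rightarrow> (real^2 \<Rightarrow> real^2) \<Rightarrow> real^2^2 \<Rightarrow> bool" where
  "linear_matrix e1 e2 f A \<longleftrightarrow>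
     (\<forall>x. f (from_coords e1 e2 x) = from_coords e1 e2 (A *v x))"

text \<open>The entry \<open>C $ i $ j\<close> (resp. \<open>D $ i $ j\<close>) is the first (resp. second) coordinate of the value
  on the \<open>i\<close>-th and \<open>j\<close>-th basis vectors. For a product with matrices \<open>\<Gamma>1\<close>, \<open>\<Gamma>2\<close>, the structure
  constant \<open>\<Gamma>\<^sub>i\<^sub>j\<close> with upper index 1 (resp. 2) is thus \<open>\<Gamma>1 $ i $ j\<close> (resp. \<open>\<Gamma>2 $ i $ j\<close>).\<close>

definition bilinear_matrices ::
    "real^2 \<Rightarrow> real^2 \<Rightarrow> (real^2 \<Rightarrow> real^2 \<Rightarrow> real^2) \<Rightarrow> real^2^2 \<Rightarrow> real^2^2 \<Rightarrow> bool" where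
  "bilinear_matrices e1 e2 f C D \<longleftrightarrow>
     (\<forall>x y. f (from_coords e1 e2 x) (from_coords e1 e2 y)
          = from_coords e1 e2 (vector [x \<bullet> (C *v y), x \<bullet> (D *v y)]))"

end

theory Submission
  imports Defs
begin

text \<open>The three coboundaries are multilinear, and the last one is alternating in its first two
  arguments. Each kernel is therefore cut out by the values of the coboundary on
  basis vectors, and the systems in the theorem are the coordinates of these values.\<close>

section \<open>Multilinearity and antisymmetry of the coboundaries\<close>

lemmas bilinear_expand =
  bilinear_ladd bilinear_radd bilinear_lmul bilinear_rmul bilinear_lsub bilinear_rsub
  bilinear_lneg bilinear_rneg

lemmas linear_expand = linear_add linear_scale linear_diff linear_neg

lemma linear_KV_d0:
  assumes "bilinear \<mu>"
  shows "linear (KV_d0 \<mu> \<xi>)"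
  by (rule linearI) (simp_all add: KV_d0_def bilinear_expand[OF assms] algebra_simps)

lemma bilinear_KV_d1:
  assumes "bilinear \<mu>" "linear f"
  shows "bilinear (KV_d1 \<mu> f)"
  unfolding bilinear_def
  by (intro conjI allI linearI)
    (simp_all add: KV_d1_def bilinear_expand[OF assms(1)] linear_expand[OF assms(2)] algebra_simps)

text \<open>Trilinearity is split into linearity in the third argument and, in
  \<open>bilinear_KV_d2\<close>, bilinearity in the first two, so that the vanishing tests for
  linear and bilinear maps can be applied one after the other.\<close>

lemma linear_KV_d2_third:
  assumes "bilinear \<mu>" "bilinear f"
  shows "linear (KV_d2 \<mu> f u v)"
  by (rule linearI)
    (simp_all add: KV_d2_def bilinear_expand[OF assms(1)] bilinear_expand[OF assms(2)] algebra_simps)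

lemma bilinear_KV_d2:
  assumes "bilinear \<mu>" "bilinear f"
  shows "bilinear (\<lambda>u v. KV_d2 \<mu> f u v w)"
  unfolding bilinear_def
  by (intro conjI allI linearI)
    (simp_all add: KV_d2_def bilinear_expand[OF assms(1)] bilinear_expand[OF assms(2)] algebra_simps)

text \<open>The eight terms form four pairs whose members are exchanged, with opposite signs, by
  swapping \<open>u\<close> and \<open>v\<close>. Together with \<open>KV_d2_swap\<close> this
  leaves \<open>e1\<close>, \<open>e2\<close> as the only pair of first arguments to
  examine.\<close>

lemma KV_d2_same: "KV_d2 \<mu> f u u w = 0"
  by (simp add: KV_d2_def)

lemma KV_d2_swap: "KV_d2 \<mu> f v u w = - KV_d2 \<mu> f u v w"
  by (simp add: KV_d2_def algebra_simps)

lemma inner_matrix_vector_2: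
  fixes C :: "real^2^2"
  shows "x \<bullet> (C *v y) = x$1 * y$1 * C$1$1 + x$1 * y$2 * C$1$2
           + x$2 * y$1 * C$2$1 + x$2 * y$2 * C$2$2"
  by (simp add: inner_vec_def matrix_vector_mult_def sum_2 algebra_simps)

text \<open>Collecting \<open>v + v\<close>, the simplifier produces the componentwise product of \<open>v\<close> with
  the constant vector \<open>2\<close>, which has to be turned back into a scalar multiple.\<close>

lemma vec_mult_2: "v * 2 = 2 *\<^sub>R v" for v :: "real^'n"
  by (simp add: vec_eq_iff)

section \<open>Coordinates in a basis of the plane\<close>

locale plane_basis =
  fixes e1 e2 :: "real^2"
  assumes basis: "is_basis2 e1 e2"
begin

text \<open>The independence half of the basis condition. It turns each vector equation on basis
  vectors into two scalar equations of a system.\<close>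

lemma combination_eq_0_iff: "a *\<^sub>R e1 + b *\<^sub>R e2 = 0 \<longleftrightarrow> a = 0 \<and> b = 0"
proof
  assume eq: "a *\<^sub>R e1 + b *\<^sub>R e2 = 0"
  have ne: "e1 \<noteq> e2" and ind: "independent {e1, e2}"
    using basis by (auto simp: is_basis2_def)
  \<comment> \<open>\<open>independentD\<close> expects the coefficients as a function on vectors;
    since \<open>e1 \<noteq> e2\<close>, the pair \<open>a\<close>, \<open>b\<close> can be encoded
    this way.\<close>
  define w where "w x = (if x = e1 then a else b)" for x
  have "(\<Sum>x\<in>{e1, e2}. w x *\<^sub>R x) = 0"
    using eq ne by (simp add: w_def)
  then have "\<forall>x\<in>{e1, e2}. w x = 0"
    using ind independentD[of "{e1, e2}" "{e1, e2}" w] by blast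
  then show "a = 0 \<and> b = 0"
    using ne by (auto simp: w_def)
qed simp

text \<open>The spanning half of the basis condition, which supplies coordinates for any
  vector.\<close>

lemma combinationE:
  obtains a b where "v = a *\<^sub>R e1 + b *\<^sub>R e2"
proof -
  have "v \<in> span {e1, e2}"
    using basis by (simp add: is_basis2_def)
  then obtain a where "v - a *\<^sub>R e1 \<in> span {e2}"
    by (auto simp: span_insert)
  then obtain b where "v - a *\<^sub>R e1 = b *\<^sub>R e2"
    by (auto simp: span_singleton)
  then show thesis
    by (intro that[of a b]) (simp add: algebra_simps)
qed

lemma from_coordsE:
  obtains x where "v = from_coords e1 e2 x"
proof -
  obtain a b where "v = a *\<^sub>R e1 + b *\<^sub>R e2"
    by (rule combinationE)
  then have "v = from_coords e1 e2 (vector [a, b])"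
    by (simp add: from_coords_def)
  then show thesis
    by (rule that)
qed

lemma linear_eq_0_iff:
  fixes f :: "real^2 \<Rightarrow> real^2"
  assumes "linear f"
  shows "(\<forall>u. f u = 0) \<longleftrightarrow> f e1 = 0 \<and> f e2 = 0"
  using basis linear_eq_0_on_span[OF assms, of "{e1, e2}"] by (auto simp: is_basis2_def)

lemma bilinear_eq_0_iff:
  fixes f :: "real^2 \<Rightarrow> real^2 \<Rightarrow> real^2"
  assumes "bilinear f"
  shows "(\<forall>u v. f u v = 0) \<longleftrightarrow> f e1 e1 = 0 \<and> f e1 e2 = 0 \<and> f e2 e1 = 0 \<and> f e2 e2 = 0"
proof -
  have right: "(\<forall>v. f u v = 0) \<longleftrightarrow> f u e1 = 0 \<and> f u e2 = 0" for u
    using assms by (intro linear_eq_0_iff) (simp add: bilinear_def)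
  have left: "(\<forall>u. f u v = 0) \<longleftrightarrow> f e1 v = 0 \<and> f e2 v = 0" for v
    using assms by (intro linear_eq_0_iff) (simp add: bilinear_def)
  show ?thesis
    \<comment> \<open>\<open>right\<close> settles the inner quantifier; distributing the outer one
      over the resulting conjunction makes \<open>left\<close> applicable to each conjunct.\<close>
    unfolding right all_conj_distrib left by blast
qed

text \<open>Evaluation at the unit coordinate vectors gives one direction, linearity the other. The
  coordinates of the image of a basis vector form a column of \<open>A\<close>, which explains the
  order of the indices.\<close>

lemma linear_matrix_iff:
  assumes "linear f"
  shows "linear_matrix e1 e2 f A \<longleftrightarrow>
    f e1 = A$1$1 *\<^sub>R e1 + A$2$1 *\<^sub>R e2 \<and> f e2 = A$1$2 *\<^sub>R e1 + A$2$2 *\<^sub>R e2"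
    (is "_ \<longleftrightarrow> ?R")
proof
  assume m: "linear_matrix e1 e2 f A"
  show ?R
    using m[unfolded linear_matrix_def, rule_format, of "vector [1, 0]"]
      m[unfolded linear_matrix_def, rule_format, of "vector [0, 1]"]
    by (simp add: from_coords_def matrix_vector_mult_def sum_2)
next
  assume ?R
  then show "linear_matrix e1 e2 f A"
    unfolding linear_matrix_def
    by (simp add: from_coords_def matrix_vector_mult_def sum_2 linear_expand[OF assms] algebra_simps)
qed

text \<open>Unit coordinate vectors pick single entries out of the two bilinear forms. Here the two
  coordinates of one value sit at the same position of the two matrices \<open>C\<close> and
  \<open>D\<close>.\<close>

lemma bilinear_matrices_iff:
  assumes "bilinear f"
  shows "bilinear_matrices e1 e2 f C D \<longleftrightarrow>
    f e1 e1 = C$1$1 *\<^sub>R e1 + D$1$1 *\<^sub>R e2 \<and> f e1 e2 = C$1$2 *\<^sub>R e1 + D$1$2 *\<^sub>R e2 \<and>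
    f e2 e1 = C$2$1 *\<^sub>R e1 + D$2$1 *\<^sub>R e2 \<and> f e2 e2 = C$2$2 *\<^sub>R e1 + D$2$2 *\<^sub>R e2"
    (is "_ \<longleftrightarrow> ?R")
proof
  assume m: "bilinear_matrices e1 e2 f C D"
  note m' = m[unfolded bilinear_matrices_def, rule_format]
  show ?R
    using m'[of "vector [1, 0]" "vector [1, 0]"] m'[of "vector [1, 0]" "vector [0, 1]"]
      m'[of "vector [0, 1]" "vector [1, 0]"] m'[of "vector [0, 1]" "vector [0, 1]"]
    by (simp add: from_coords_def inner_matrix_vector_2)
next
  assume ?R
  then show "bilinear_matrices e1 e2 f C D"
    unfolding bilinear_matrices_def
    by (simp add: from_coords_def inner_matrix_vector_2 bilinear_expand[OF assms] algebra_simps)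
qed

text \<open>The systems are imposed on some matrix of the map; this provides that matrix when
  passing from a kernel to its system.\<close>

lemma linear_matrixE:
  assumes "linear f"
  obtains \<alpha> \<beta> \<gamma> \<delta> where
    "linear_matrix e1 e2 f (vector [vector [\<alpha>, \<beta>], vector [\<gamma>, \<delta>]])"
proof -
  obtain \<alpha> \<gamma> where 1: "f e1 = \<alpha> *\<^sub>R e1 + \<gamma> *\<^sub>R e2" by (rule combinationE)
  obtain \<beta> \<delta> where 2: "f e2 = \<beta> *\<^sub>R e1 + \<delta> *\<^sub>R e2" by (rule combinationE)
  show thesis
    by (rule that[of \<alpha> \<beta> \<gamma> \<delta>]) (simp add: linear_matrix_iff[OF assms] 1 2)
qed

lemma bilinear_matricesE:
  assumes "bilinear f"
  obtains a b c d a' b' c' d' where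
    "bilinear_matrices e1 e2 f (vector [vector [a, b], vector [c, d]])
       (vector [vector [a', b'], vector [c', d']])"
proof -
  obtain a a' where 1: "f e1 e1 = a *\<^sub>R e1 + a' *\<^sub>R e2" by (rule combinationE)
  obtain b b' where 2: "f e1 e2 = b *\<^sub>R e1 + b' *\<^sub>R e2" by (rule combinationE)
  obtain c c' where 3: "f e2 e1 = c *\<^sub>R e1 + c' *\<^sub>R e2" by (rule combinationE)
  obtain d d' where 4: "f e2 e2 = d *\<^sub>R e1 + d' *\<^sub>R e2" by (rule combinationE)
  show thesis
    by (rule that[of a b c d a' b' c' d']) (simp add: bilinear_matrices_iff[OF assms] 1 2 3 4)
qed

end

section \<open>The cocycle equations in terms of structure constants\<close>

locale plane_product = plane_basis +
  fixes \<mu> :: "real^2 \<Rightarrow> real^2 \<Rightarrow> real^2" and \<Gamma>1 \<Gamma>2 :: "real^2^2"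
  assumes bilin: "bilinear \<mu>"
    and matrices: "bilinear_matrices e1 e2 \<mu> \<Gamma>1 \<Gamma>2"
begin

lemma products:
  "\<mu> e1 e1 = \<Gamma>1$1$1 *\<^sub>R e1 + \<Gamma>2$1$1 *\<^sub>R e2"
  "\<mu> e1 e2 = \<Gamma>1$1$2 *\<^sub>R e1 + \<Gamma>2$1$2 *\<^sub>R e2"
  "\<mu> e2 e1 = \<Gamma>1$2$1 *\<^sub>R e1 + \<Gamma>2$2$1 *\<^sub>R e2"
  "\<mu> e2 e2 = \<Gamma>1$2$2 *\<^sub>R e1 + \<Gamma>2$2$2 *\<^sub>R e2"
  using matrices by (auto simp: bilinear_matrices_iff[OF bilin])

lemma KV_d0_eq_0_iff:
  "(\<forall>u. KV_d0 \<mu> (from_coords e1 e2 \<xi>) u = 0) \<longleftrightarrow>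
    (\<Gamma>1$2$1 - \<Gamma>1$1$2) * \<xi>$2 = 0 \<and>
    (\<Gamma>1$1$2 - \<Gamma>1$2$1) * \<xi>$1 = 0 \<and>
    (\<Gamma>2$2$1 - \<Gamma>2$1$2) * \<xi>$2 = 0 \<and>
    (\<Gamma>2$1$2 - \<Gamma>2$2$1) * \<xi>$1 = 0"
proof -
  let ?d = "KV_d0 \<mu> (from_coords e1 e2 \<xi>)"
  \<comment> \<open>The value at \<open>u\<close> is the commutator of \<xi> with \<open>u\<close>,
    so only the component of \<xi> along the other basis vector survives.\<close>
  have "?d e1 = ((\<Gamma>1$2$1 - \<Gamma>1$1$2) * \<xi>$2) *\<^sub>R e1 + ((\<Gamma>2$2$1 - \<Gamma>2$1$2) * \<xi>$2) *\<^sub>R e2"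
    "?d e2 = ((\<Gamma>1$1$2 - \<Gamma>1$2$1) * \<xi>$1) *\<^sub>R e1 + ((\<Gamma>2$1$2 - \<Gamma>2$2$1) * \<xi>$1) *\<^sub>R e2"
    by (simp_all add: KV_d0_def from_coords_def bilinear_expand[OF bilin] products algebra_simps)
  then show ?thesis
    by (simp only: linear_eq_0_iff[OF linear_KV_d0[OF bilin]] combination_eq_0_iff) blast
qed

text \<open>The coboundary of \<open>f\<close> vanishes exactly when \<open>f\<close> is a
  derivation of \<mu>; the eight equations are the Leibniz rule on the four pairs of basis vectors,
  read in coordinates.\<close>

lemma KV_d1_eq_0_iff:
  assumes f: "linear f"
    and m: "linear_matrix e1 e2 f (vector [vector [\<alpha>, \<beta>], vector [\<gamma>, \<delta>]])"
  shows "(\<forall>u v. KV_d1 \<mu> f u v = 0) \<longleftrightarrow>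
        - \<Gamma>1$1$1 * \<alpha> + \<Gamma>2$1$1 * \<beta>
          - (\<Gamma>1$1$2 + \<Gamma>1$2$1) * \<gamma> = 0 \<and>
        (\<Gamma>2$1$2 - \<Gamma>1$1$1) * \<beta> - \<Gamma>1$2$2 * \<gamma> - \<Gamma>1$1$2 * \<delta> = 0 \<and>
        (\<Gamma>2$2$1 - \<Gamma>1$1$1) * \<beta> - \<Gamma>1$2$2 * \<gamma> - \<Gamma>1$2$1 * \<delta> = 0 \<and>
        \<Gamma>1$2$2 * \<alpha> + (\<Gamma>2$2$2 - \<Gamma>1$1$2 - \<Gamma>1$2$1) * \<beta>
          - 2 * \<Gamma>1$2$2 * \<delta> = 0 \<and>
        - 2 * \<Gamma>2$1$1 * \<alpha> + (\<Gamma>1$1$1 - \<Gamma>2$1$2 - \<Gamma>2$2$1) * \<gamma>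
          + \<Gamma>2$1$1 * \<delta> = 0 \<and>
        - \<Gamma>2$1$2 * \<alpha> - \<Gamma>2$1$1 * \<beta>
          + (\<Gamma>1$1$2 - \<Gamma>2$2$2) * \<gamma> = 0 \<and>
        - \<Gamma>2$2$1 * \<alpha> - \<Gamma>2$1$1 * \<beta>
          + (\<Gamma>1$2$1 - \<Gamma>2$2$2) * \<gamma> = 0 \<and>
        - (\<Gamma>2$2$1 + \<Gamma>2$1$2) * \<beta> + \<Gamma>1$2$2 * \<gamma>
          - \<Gamma>2$2$2 * \<delta> = 0"
proof -
  have fv: "f e1 = \<alpha> *\<^sub>R e1 + \<gamma> *\<^sub>R e2" "f e2 = \<beta> *\<^sub>R e1 + \<delta> *\<^sub>R e2"
    using m by (simp_all add: linear_matrix_iff[OF f])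
  \<comment> \<open>The \<open>e1\<close>-coordinates of the four values are the first four
    equations, the \<open>e2\<close>-coordinates the last four; \<open>blast\<close> does the
    reordering. In the value at \<open>e2\<close>, \<open>e1\<close>, the coefficient
    \<open>\<Gamma>2$2$1 - \<Gamma>1$1$1\<close> of \<beta> comes from
    \<open>f (\<mu> e2 e1)\<close> and \<open>- \<mu> (f e2) e1\<close>.\<close>
  have "KV_d1 \<mu> f e1 e1 =
      (- \<Gamma>1$1$1 * \<alpha> + \<Gamma>2$1$1 * \<beta> - (\<Gamma>1$1$2 + \<Gamma>1$2$1) * \<gamma>) *\<^sub>R e1 +
      (- 2 * \<Gamma>2$1$1 * \<alpha> + (\<Gamma>1$1$1 - \<Gamma>2$1$2 - \<Gamma>2$2$1) * \<gamma> + \<Gamma>2$1$1 * \<delta>) *\<^sub>R e2"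
    "KV_d1 \<mu> f e1 e2 =
      ((\<Gamma>2$1$2 - \<Gamma>1$1$1) * \<beta> - \<Gamma>1$2$2 * \<gamma> - \<Gamma>1$1$2 * \<delta>) *\<^sub>R e1 +
      (- \<Gamma>2$1$2 * \<alpha> - \<Gamma>2$1$1 * \<beta> + (\<Gamma>1$1$2 - \<Gamma>2$2$2) * \<gamma>) *\<^sub>R e2"
    "KV_d1 \<mu> f e2 e1 =
      ((\<Gamma>2$2$1 - \<Gamma>1$1$1) * \<beta> - \<Gamma>1$2$2 * \<gamma> - \<Gamma>1$2$1 * \<delta>) *\<^sub>R e1 +
      (- \<Gamma>2$2$1 * \<alpha> - \<Gamma>2$1$1 * \<beta> + (\<Gamma>1$2$1 - \<Gamma>2$2$2) * \<gamma>) *\<^sub>R e2"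
    "KV_d1 \<mu> f e2 e2 =
      (\<Gamma>1$2$2 * \<alpha> + (\<Gamma>2$2$2 - \<Gamma>1$1$2 - \<Gamma>1$2$1) * \<beta> - 2 * \<Gamma>1$2$2 * \<delta>) *\<^sub>R e1 +
      (- (\<Gamma>2$2$1 + \<Gamma>2$1$2) * \<beta> + \<Gamma>1$2$2 * \<gamma> - \<Gamma>2$2$2 * \<delta>) *\<^sub>R e2"
    by (simp_all add: KV_d1_def bilinear_expand[OF bilin] linear_expand[OF f] products fv
        vec_mult_2 algebra_simps)
  then show ?thesis
    by (simp only: bilinear_eq_0_iff[OF bilinear_KV_d1[OF bilin f]] combination_eq_0_iff) blast
qed

text \<open>\<open>KV_d2 \<mu> F u v w\<close> is the derivative at \<mu>, in direction
  \<open>F\<close>, of the associator of \<open>u\<close>, \<open>v\<close>, \<open>w\<close> minus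
  that of \<open>v\<close>, \<open>u\<close>, \<open>w\<close>: the linearized KV identity. By
  antisymmetry two basis triples suffice, hence four scalar equations.\<close>

lemma KV_d2_eq_0_iff:
  assumes F: "bilinear F"
    and m: "bilinear_matrices e1 e2 F
      (vector [vector [e, f], vector [g, h]]) (vector [vector [i, j], vector [k, l]])"
  shows "(\<forall>u v w. KV_d2 \<mu> F u v w = 0) \<longleftrightarrow>
        (\<Gamma>1$1$2 - \<Gamma>1$2$1) * e + \<Gamma>1$2$2 * i + (\<Gamma>1$1$1 - \<Gamma>2$2$1) * f
          + \<Gamma>1$2$1 * j + (\<Gamma>2$1$2 - \<Gamma>1$1$1 - \<Gamma>2$2$1) * g
          - (\<Gamma>1$1$2 + \<Gamma>1$2$1) * k + \<Gamma>2$1$1 * h = 0 \<and>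
        \<Gamma>2$2$1 * e + (\<Gamma>1$1$2 - 2 * \<Gamma>1$2$1 + \<Gamma>2$2$2) * i + \<Gamma>2$1$1 * f
          - 2 * \<Gamma>2$1$1 * g + (\<Gamma>1$1$1 - 2 * \<Gamma>2$2$1) * k + \<Gamma>2$1$1 * l = 0 \<and>
        - \<Gamma>1$2$2 * e + (2 * \<Gamma>1$1$2 - \<Gamma>2$2$2) * f + 2 * \<Gamma>1$2$2 * j
          - \<Gamma>1$2$2 * k + (2 * \<Gamma>2$1$2 - \<Gamma>1$1$1 - \<Gamma>2$2$1) * h
          - \<Gamma>1$1$2 * l = 0 \<and>
        - \<Gamma>1$2$2 * i + (\<Gamma>2$1$2 + \<Gamma>2$2$1) * f
          + (\<Gamma>1$1$2 - \<Gamma>1$2$1 + \<Gamma>2$2$2) * j - \<Gamma>2$1$2 * g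
          + (\<Gamma>1$1$2 - \<Gamma>2$2$2) * k - \<Gamma>2$1$1 * h + (\<Gamma>2$1$2 - \<Gamma>2$2$1) * l = 0"
proof -
  have Fv: "F e1 e1 = e *\<^sub>R e1 + i *\<^sub>R e2" "F e1 e2 = f *\<^sub>R e1 + j *\<^sub>R e2"
    "F e2 e1 = g *\<^sub>R e1 + k *\<^sub>R e2" "F e2 e2 = h *\<^sub>R e1 + l *\<^sub>R e2"
    using m by (simp_all add: bilinear_matrices_iff[OF F])
  have on_basis: "(\<forall>u v w. KV_d2 \<mu> F u v w = 0) \<longleftrightarrow>
      KV_d2 \<mu> F e1 e2 e1 = 0 \<and> KV_d2 \<mu> F e1 e2 e2 = 0"
  proof -
    \<comment> \<open>With \<open>w\<close> fixed, the diagonal pairs give zero and the instance of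
      \<open>KV_d2_swap\<close> reduces the pair \<open>e2\<close>, \<open>e1\<close> to
      \<open>e1\<close>, \<open>e2\<close>. Linearity in \<open>w\<close> then finishes the
      reduction.\<close>
    have "(\<forall>u v. KV_d2 \<mu> F u v w = 0) \<longleftrightarrow> KV_d2 \<mu> F e1 e2 w = 0" for w
      by (simp add: bilinear_eq_0_iff[OF bilinear_KV_d2[OF bilin F]] KV_d2_same
          KV_d2_swap[of \<mu> F e2 e1])
    then show ?thesis
      using linear_eq_0_iff[OF linear_KV_d2_third[OF bilin F], of e1 e2] by blast
  qed
  \<comment> \<open>The first value carries equations one and two, the second value three and four.
    In the last equation the term in \<open>g\<close> comes solely from
    \<open>- \<mu> (F e2 e1) e2\<close>, hence its constant \<open>\<Gamma>2$1$2\<close>.\<close>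
  have "KV_d2 \<mu> F e1 e2 e1 =
      ((\<Gamma>1$1$2 - \<Gamma>1$2$1) * e + \<Gamma>1$2$2 * i + (\<Gamma>1$1$1 - \<Gamma>2$2$1) * f
        + \<Gamma>1$2$1 * j + (\<Gamma>2$1$2 - \<Gamma>1$1$1 - \<Gamma>2$2$1) * g - (\<Gamma>1$1$2 + \<Gamma>1$2$1) * k + \<Gamma>2$1$1 * h) *\<^sub>R e1 +
      (\<Gamma>2$2$1 * e + (\<Gamma>1$1$2 - 2 * \<Gamma>1$2$1 + \<Gamma>2$2$2) * i
        + \<Gamma>2$1$1 * f - 2 * \<Gamma>2$1$1 * g + (\<Gamma>1$1$1 - 2 * \<Gamma>2$2$1) * k + \<Gamma>2$1$1 * l) *\<^sub>R e2"
    "KV_d2 \<mu> F e1 e2 e2 =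
      (- \<Gamma>1$2$2 * e + (2 * \<Gamma>1$1$2 - \<Gamma>2$2$2) * f
        + 2 * \<Gamma>1$2$2 * j - \<Gamma>1$2$2 * k + (2 * \<Gamma>2$1$2 - \<Gamma>1$1$1 - \<Gamma>2$2$1) * h - \<Gamma>1$1$2 * l) *\<^sub>R e1 +
      (- \<Gamma>1$2$2 * i + (\<Gamma>2$1$2 + \<Gamma>2$2$1) * f
        + (\<Gamma>1$1$2 - \<Gamma>1$2$1 + \<Gamma>2$2$2) * j - \<Gamma>2$1$2 * g + (\<Gamma>1$1$2 - \<Gamma>2$2$2) * k - \<Gamma>2$1$1 * h + (\<Gamma>2$1$2 - \<Gamma>2$2$1) * l) *\<^sub>R e2"
    by (simp_all add: KV_d2_def bilinear_expand[OF bilin] bilinear_expand[OF F] products Fv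
        vec_mult_2 algebra_simps)
  then show ?thesis
    by (simp only: on_basis combination_eq_0_iff) blast
qed

end

theorem proposition3:
  fixes e1 e2 :: "real^2"
    and \<mu> :: "real^2 \<Rightarrow> real^2 \<Rightarrow> real^2"
    and \<Gamma>1 \<Gamma>2 :: "real^2^2"
  assumes "is_basis2 e1 e2"
    and "KV_algebra \<mu>"
    and "bilinear_matrices e1 e2 \<mu> \<Gamma>1 \<Gamma>2"
  shows "
    (ker_d0 \<mu> = {from_coords e1 e2 \<xi> | \<xi>. from_coords e1 e2 \<xi> \<in> KV_C0 \<mu> \<and>
        (\<Gamma>1$2$1 - \<Gamma>1$1$2) * \<xi>$2 = 0 \<and>
        (\<Gamma>1$1$2 - \<Gamma>1$2$1) * \<xi>$1 = 0 \<and>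
        (\<Gamma>2$2$1 - \<Gamma>2$1$2) * \<xi>$2 = 0 \<and>
        (\<Gamma>2$1$2 - \<Gamma>2$2$1) * \<xi>$1 = 0}) \<and>
    (ker_d1 \<mu> = {f1 \<in> KV_C1. \<exists>\<alpha> \<beta> \<gamma> \<delta>.
        linear_matrix e1 e2 f1 (vector [vector [\<alpha>, \<beta>], vector [\<gamma>, \<delta>]]) \<and>
        - \<Gamma>1$1$1 * \<alpha> + \<Gamma>2$1$1 * \<beta>
          - (\<Gamma>1$1$2 + \<Gamma>1$2$1) * \<gamma> = 0 \<and>
        (\<Gamma>2$1$2 - \<Gamma>1$1$1) * \<beta> - \<Gamma>1$2$2 * \<gamma> - \<Gamma>1$1$2 * \<delta> = 0 \<and>
        (\<Gamma>2$2$1 - \<Gamma>1$1$1) * \<beta> - \<Gamma>1$2$2 * \<gamma> - \<Gamma>1$2$1 * \<delta> = 0 \<and>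
        \<Gamma>1$2$2 * \<alpha> + (\<Gamma>2$2$2 - \<Gamma>1$1$2 - \<Gamma>1$2$1) * \<beta>
          - 2 * \<Gamma>1$2$2 * \<delta> = 0 \<and>
        - 2 * \<Gamma>2$1$1 * \<alpha> + (\<Gamma>1$1$1 - \<Gamma>2$1$2 - \<Gamma>2$2$1) * \<gamma>
          + \<Gamma>2$1$1 * \<delta> = 0 \<and>
        - \<Gamma>2$1$2 * \<alpha> - \<Gamma>2$1$1 * \<beta>
          + (\<Gamma>1$1$2 - \<Gamma>2$2$2) * \<gamma> = 0 \<and>
        - \<Gamma>2$2$1 * \<alpha> - \<Gamma>2$1$1 * \<beta>
          + (\<Gamma>1$2$1 - \<Gamma>2$2$2) * \<gamma> = 0 \<and>
        - (\<Gamma>2$2$1 + \<Gamma>2$1$2) * \<beta> + \<Gamma>1$2$2 * \<gamma>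
          - \<Gamma>2$2$2 * \<delta> = 0}) \<and>
    (ker_d2 \<mu> = {f2 \<in> KV_C2. \<exists>e f g h i j k l.
        bilinear_matrices e1 e2 f2
          (vector [vector [e, f], vector [g, h]]) (vector [vector [i, j], vector [k, l]]) \<and>
        (\<Gamma>1$1$2 - \<Gamma>1$2$1) * e + \<Gamma>1$2$2 * i + (\<Gamma>1$1$1 - \<Gamma>2$2$1) * f
          + \<Gamma>1$2$1 * j + (\<Gamma>2$1$2 - \<Gamma>1$1$1 - \<Gamma>2$2$1) * g
          - (\<Gamma>1$1$2 + \<Gamma>1$2$1) * k + \<Gamma>2$1$1 * h = 0 \<and>
        \<Gamma>2$2$1 * e + (\<Gamma>1$1$2 - 2 * \<Gamma>1$2$1 + \<Gamma>2$2$2) * i + \<Gamma>2$1$1 * f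
          - 2 * \<Gamma>2$1$1 * g + (\<Gamma>1$1$1 - 2 * \<Gamma>2$2$1) * k + \<Gamma>2$1$1 * l = 0 \<and>
        - \<Gamma>1$2$2 * e + (2 * \<Gamma>1$1$2 - \<Gamma>2$2$2) * f + 2 * \<Gamma>1$2$2 * j
          - \<Gamma>1$2$2 * k + (2 * \<Gamma>2$1$2 - \<Gamma>1$1$1 - \<Gamma>2$2$1) * h
          - \<Gamma>1$1$2 * l = 0 \<and>
        - \<Gamma>1$2$2 * i + (\<Gamma>2$1$2 + \<Gamma>2$2$1) * f
          + (\<Gamma>1$1$2 - \<Gamma>1$2$1 + \<Gamma>2$2$2) * j - \<Gamma>2$1$2 * g
          + (\<Gamma>1$1$2 - \<Gamma>2$2$2) * k - \<Gamma>2$1$1 * h + (\<Gamma>2$1$2 - \<Gamma>2$2$1) * l = 0})"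
proof -
  interpret plane_product e1 e2 \<mu> \<Gamma>1 \<Gamma>2
    using assms by unfold_locales (simp_all add: KV_algebra_def)
  show ?thesis
  \<comment> \<open>Cases 1, 3, 5 lead from a kernel to its system after choosing coordinates or
    matrices; cases 2, 4, 6 lead back.\<close>
  proof (intro conjI set_eqI iffI, goal_cases)
    case (1 x)
    then have "x \<in> KV_C0 \<mu>" and d: "\<forall>u. KV_d0 \<mu> x u = 0"
      by (auto simp: ker_d0_def)
    moreover obtain \<xi> where \<xi>: "x = from_coords e1 e2 \<xi>"
      by (rule from_coordsE)
    ultimately show ?case
      using d[unfolded \<xi> KV_d0_eq_0_iff] by blast
  next
    case (2 x)
    then show ?case
      unfolding ker_d0_def using KV_d0_eq_0_iff by blast
  next
    case (3 F)
    then have F: "linear F" and d: "\<forall>u v. KV_d1 \<mu> F u v = 0"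
      by (auto simp: ker_d1_def KV_C1_def)
    obtain \<alpha> \<beta> \<gamma> \<delta> where
      m: "linear_matrix e1 e2 F (vector [vector [\<alpha>, \<beta>], vector [\<gamma>, \<delta>]])"
      using linear_matrixE[OF F] .
    show ?case
      using F m d[unfolded KV_d1_eq_0_iff[OF F m]] unfolding KV_C1_def by blast
  next
    case (4 F)
    then have F: "linear F"
      unfolding KV_C1_def by blast
    \<comment> \<open>The matrix is left open in the equivalence, so it applies to whichever matrix
      witnesses membership.\<close>
    have "\<forall>u v. KV_d1 \<mu> F u v = 0"
      using 4 KV_d1_eq_0_iff[OF F] by blast
    with F show ?case
      by (simp add: ker_d1_def KV_C1_def)
  next
    case (5 F)
    then have F: "bilinear F" and d: "\<forall>u v w. KV_d2 \<mu> F u v w = 0"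
      by (auto simp: ker_d2_def KV_C2_def)
    obtain e f g h i j k l where
      m: "bilinear_matrices e1 e2 F
        (vector [vector [e, f], vector [g, h]]) (vector [vector [i, j], vector [k, l]])"
      using bilinear_matricesE[OF F] .
    show ?case
      using F m d[unfolded KV_d2_eq_0_iff[OF F m]] unfolding KV_C2_def by blast
  next
    case (6 F)
    then have F: "bilinear F"
      unfolding KV_C2_def by blast
    have "\<forall>u v w. KV_d2 \<mu> F u v w = 0"
      using 6 KV_d2_eq_0_iff[OF F] by blast
    with F show ?case
      by (simp add: ker_d2_def KV_C2_def)
  qed
qed

end
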